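(* Let $(R,\cdot,(P_\omega)_{\omega\in S},\theta)$ be a Rota-Baxter family Hom-associative algebra of weight $\lambda$ that has codimension $1$ in a vector space $E$, and let $V$ be a space complement of $R$ in $E$ with basis $\{x\}$. Then there is a bijection $\Phi:\mathcal{F}(R)\to\mathcal{O}(R,V)$ from the set of flag datums of $R$ to the set of Rota-Baxter family Hom extending structures of $R$ through $V$, sending the flag datum $\Omega(R)=(l,r,t_r,t_l,a_1,\bar k_1,(b_\omega)_{\omega\in S},(\bar k_\omega)_{\omega\in S},a_2,\bar k_2)$ to the extending structure $\Omega(R,V)=(\triangleright,\triangleleft,\rightharpoonup,\leftharpoonup,f,\cdot_V,(Q_\omega)_{\omega\in S},(P_{\omega,V})_{\omega\in S},\eta,\theta_V)$ defined, for $a\in R$ and $\omega\in S$, by $$a\triangleright x=l(a)x,\quad x\triangleleft a=r(a)x,\quad a\leftharpoonup x=t_l(a),\quad x\rightharpoonup a=t_r(a),\quad f(x,x)=a_1,$$ $$x\cdot_V x=\bar k_1x,\quad Q_\omega(x)=b_\omega,\quad P_{\omega,V}(x)=\bar k_\omega x,\quad \eta(x)=a_2,\quad \theta_V(x)=\bar k_2x.$$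
   Context: Fix a field $\mathbf{k}$, a semigroup $S$ and $\lambda\in\mathbf{k}$. All vector spaces and (bi)linear maps are over $\mathbf{k}$. A Rota-Baxter family Hom-associative algebra (of weight $\lambda$) is a 4-tuple $(R,\cdot,(P_\omega)_{\omega\in S},\theta)$, with $R$ a vector space, $\cdot:R\times R\to R$ bilinear, $P_\omega:R\to R$ ($\omega\in S$) and $\theta:R\to R$ linear, such that for all $x,y,z\in R$ and $\omega,\alpha,\beta\in S$: $\theta(x)\cdot(y\cdot z)=(x\cdot y)\cdot\theta(z)$; $P_\alpha(x)\cdot P_\beta(y)=P_{\alpha\beta}(P_\alpha(x)\cdot y+x\cdot P_\beta(y)+\lambda\,x\cdot y)$; $P_\omega(\theta(x))=\theta(P_\omega(x))$. A space complement of a subspace $R$ in $E$ is a subspace $V$ with $E=R+V$, $R\cap V=\{0\}$. Extending datum of $R$ through a vector space $V$: a system $\Omega(R,V)=(\triangleright,\triangleleft,\rightharpoonup,\leftharpoonup,f,\cdot_V,(Q_\omega)_{\omega\in S},(P_{\omega,V})_{\omega\in S},\eta,\theta_V)$ of bilinear maps $\triangleright:R\times V\to V$, $\triangleleft:V\times R\to V$, $\rightharpoonup:V\times R\to R$, $\leftharpoonup:R\times V\to R$, $f:V\times V\to R$, $\cdot_V:V\times V\to V$ and linear maps $Q_\omega:V\to R$, $P_{\omega,V}:V\to V$ ($\omega\in S$), $\eta:V\to R$, $\theta_V:V\to V$. On $R\times V$ define $(a,x)\,\bar\cdot\,(b,y)=(ab+a\leftharpoonup y+x\rightharpoonup b+f(x,y),\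 a\triangleright y+x\triangleleft b+x\cdot_V y)$, $\bar P_\omega(a,x)=(P_\omega(a)+Q_\omega(x),P_{\omega,V}(x))$, $\bar\theta(a,x)=(\theta(a)+\eta(x),\theta_V(x))$. The datum is a Rota-Baxter family Hom extending structure of $R$ through $V$ if $(R\times V,\bar\cdot,(\bar P_\omega)_{\omega\in S},\bar\theta)$ is a Rota-Baxter family Hom-associative algebra of weight $\lambda$. $\mathcal{O}(R,V)$ is the set of all such structures. A flag datum of $R$ is a 10-tuple $\Omega(R)=(l,r,t_r,t_l,a_1,\bar k_1,(b_\omega)_{\omega\in S},(\bar k_\omega)_{\omega\in S},a_2,\bar k_2)$ with $l,r:R\to\mathbf{k}$ and $t_r,t_l:R\to R$ linear, $a_1,a_2,b_\omega\in R$ and $\bar k_1,\bar k_2,\bar k_\omega\in\mathbf{k}$ ($\omega\in S$), such that for all $a,b\in R$ and $\alpha,\beta\in S$: (F1) $l(ab)\bar k_2=l(\theta(a))l(b)$; (F2) $r(a)r(\theta(b))=r(ab)\bar k_2$; (F3) $l(a)r(\theta(b))=l(\theta(a))r(b)$; (F4) $l(P_\alpha(a))\bar k_\beta=\bar k_{\alpha\beta}\big(l(P_\alpha(a))+l(a)\bar k_\beta+\lambda l(a)\big)$; (F5) $\bar k_\alpha r(P_\beta(a))=\bar k_{\alpha\beta}\big(\bar k_\alpha r(a)+r(P_\beta(a))+\lambda r(a)\big)$; (F6) $(ab)a_2+t_l(ab)\bar k_2=\theta(a)t_l(b)+t_l(\theta(a))l(b)$; (F7) $t_r(a)\theta(b)+r(a)t_r(\theta(b))=a_2(ab)+\bar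 k_2t_r(ab)$; (F8) $t_l(a)\theta(b)+l(a)t_r(\theta(b))=\theta(a)t_r(b)+t_l(\theta(a))r(b)$; (F9) $a_1\theta(a)+\bar k_1t_r(\theta(a))=a_2t_r(a)+t_l(a_2)r(a)+\bar k_2t_r(t_r(a))+a_1\bar k_2r(a)$; (F10) $\bar k_1r(\theta(a))=l(a_2)r(a)+\bar k_2r(t_r(a))+\bar k_1\bar k_2r(a)$; (F11) $t_l(a)a_2+t_l(t_l(a))\bar k_2+l(a)t_r(a_2)+l(a)\bar k_2a_1=\theta(a)a_1+t_l(\theta(a))\bar k_1$; (F12) $l(t_l(a))\bar k_2+l(a)r(a_2)+l(a)\bar k_1\bar k_2=l(\theta(a))\bar k_1$; (F13) $t_r(a)a_2+t_l(t_r(a))\bar k_2+r(a)t_r(a_2)+r(a)\bar k_2a_1=a_2t_l(a)+t_l(a_2)l(a)+\bar k_2t_r(t_l(a))+\bar k_2l(a)a_1$; (F14) $l(t_r(a))\bar k_2+r(a)r(a_2)+r(a)\bar k_1\bar k_2=l(a_2)l(a)+\bar k_2r(t_l(a))+\bar k_2\bar k_1l(a)$; (F15) $a_1a_2+t_l(a_1)\bar k_2+\bar k_1t_r(a_2)=a_2a_1+\bar k_1t_l(a_2)+\bar k_2t_r(a_1)$; (F16) $l(a_1)\bar k_2+\bar k_1r(a_2)=l(a_2)\bar k_1+\bar k_2r(a_1)$; (F17) $P_\alpha(a)b_\beta+t_l(P_\alpha(a))\bar k_\beta=P_{\alpha\beta}\big(t_l(P_\alpha(a))+ab_\beta+t_l(a)\bar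 k_\beta+\lambda t_l(a)\big)+b_{\alpha\beta}\big(l(P_\alpha(a))+l(a)\bar k_\beta+\lambda l(a)\big)$; (F18) $b_\alpha P_\beta(a)+\bar k_\alpha t_r(P_\beta(a))=P_{\alpha\beta}\big(b_\alpha a+\bar k_\alpha t_r(a)+t_r(P_\beta(a))+\lambda t_r(a)\big)+b_{\alpha\beta}\big(\bar k_\alpha r(a)+r(P_\beta(a))+\lambda r(a)\big)$; (F19) $b_\alpha b_\beta+t_l(b_\alpha)\bar k_\beta+\bar k_\alpha t_r(b_\beta)+a_1\bar k_\alpha\bar k_\beta=P_{\alpha\beta}\big(t_l(b_\alpha)+\bar k_\alpha a_1+t_r(b_\beta)+\bar k_\beta a_1+\lambda a_1\big)+b_{\alpha\beta}\big(l(b_\alpha)+\bar k_\alpha\bar k_1+r(b_\beta)+\bar k_1\bar k_\beta+\lambda\bar k_1\big)$; (F20) $l(b_\alpha)\bar k_\beta+\bar k_\alpha r(b_\beta)+\bar k_1\bar k_\alpha\bar k_\beta=\bar k_{\alpha\beta}\big(l(b_\alpha)+\bar k_1\bar k_\alpha+r(b_\beta)+\bar k_1\bar k_\beta+\lambda\bar k_1\big)$; (F21) $\theta(b_\alpha)+\bar k_\alpha a_2=P_\alpha(a_2)+\bar k_2b_\alpha$. $\mathcal{F}(R)$ denotes the set of all flag datums of $R$. *)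

theory Defs
  imports "HOL-Library.FuncSet" "HOL-Analysis.Product_Vector"
begin

text \<open>
  Vector spaces are subspaces, given as carrier sets, of an ambient type with a scalar
  multiplication in the sense of \<^locale>\<open>vector_space\<close>. A map between carrier sets is
  relevant only on its domain. Wherever sets of maps are formed, the maps are normalised to be
  \<^const>\<open>undefined\<close> off their domain, so that equality in the logic is equality of maps.
\<close>

definition linear_map_on ::
    "('k::field \<Rightarrow> 'a::ab_group_add \<Rightarrow> 'a) \<Rightarrow> ('k \<Rightarrow> 'b::ab_group_add \<Rightarrow> 'b) \<Rightarrow>
     'a set \<Rightarrow> 'b set \<Rightarrow> ('a \<Rightarrow> 'b) \<Rightarrow> bool" where
  "linear_map_on s t A B f \<longleftrightarrow>
     (\<forall>x\<in>A. f x \<in> B) \<and>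
     (\<forall>x\<in>A. \<forall>y\<in>A. f (x + y) = f x + f y) \<and>
     (\<forall>c. \<forall>x\<in>A. f (s c x) = t c (f x))"

definition bilinear_map_on ::
    "('k::field \<Rightarrow> 'a::ab_group_add \<Rightarrow> 'a) \<Rightarrow> ('k \<Rightarrow> 'b::ab_group_add \<Rightarrow> 'b) \<Rightarrow>
     ('k \<Rightarrow> 'c::ab_group_add \<Rightarrow> 'c) \<Rightarrow> 'a set \<Rightarrow> 'b set \<Rightarrow> 'c set \<Rightarrow> ('a \<Rightarrow> 'b \<Rightarrow> 'c) \<Rightarrow> bool" where
  "bilinear_map_on s t u A B C f \<longleftrightarrow>
     (\<forall>x\<in>A. linear_map_on t u B C (f x)) \<and>
     (\<forall>y\<in>B. linear_map_on s u A C (\<lambda>x. f x y))"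

definition Lin ::
    "('k::field \<Rightarrow> 'a::ab_group_add \<Rightarrow> 'a) \<Rightarrow> ('k \<Rightarrow> 'b::ab_group_add \<Rightarrow> 'b) \<Rightarrow>
     'a set \<Rightarrow> 'b set \<Rightarrow> ('a \<Rightarrow> 'b) set" where
  "Lin s t A B = {f \<in> A \<rightarrow>\<^sub>E B. linear_map_on s t A B f}"

definition Bilin ::
    "('k::field \<Rightarrow> 'a::ab_group_add \<Rightarrow> 'a) \<Rightarrow> ('k \<Rightarrow> 'b::ab_group_add \<Rightarrow> 'b) \<Rightarrow>
     ('k \<Rightarrow> 'c::ab_group_add \<Rightarrow> 'c) \<Rightarrow> 'a set \<Rightarrow> 'b set \<Rightarrow> 'c set \<Rightarrow> ('a \<Rightarrow> 'b \<Rightarrow> 'c) set" where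
  "Bilin s t u A B C = {f \<in> A \<rightarrow>\<^sub>E (B \<rightarrow>\<^sub>E C). bilinear_map_on s t u A B C f}"

definition space_complement :: "('k::field \<Rightarrow> 'e::ab_group_add \<Rightarrow> 'e) \<Rightarrow> 'e set \<Rightarrow> 'e set \<Rightarrow> bool" where
  "space_complement s R V \<longleftrightarrow>
     module.subspace s V \<and> (\<forall>e. \<exists>a\<in>R. \<exists>v\<in>V. e = a + v) \<and> R \<inter> V = {0}"

text \<open>
  The codimension of \<open>R\<close>, i.e. the dimension of the quotient by \<open>R\<close>, is expressed as the
  dimension of a complement, all complements being isomorphic to the quotient.
\<close>

definition has_codim :: "('k::field \<Rightarrow> 'e::ab_group_add \<Rightarrow> 'e) \<Rightarrow> 'e set \<Rightarrow> nat \<Rightarrow> bool" where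
  "has_codim s R n \<longleftrightarrow>
     (\<exists>B. finite B \<and> card B = n \<and> \<not> module.dependent s B \<and>
          space_complement s R (module.span s B))"

definition rbf_hom_algebra ::
    "('k::field \<Rightarrow> 'a::ab_group_add \<Rightarrow> 'a) \<Rightarrow> 'k \<Rightarrow> 'a set \<Rightarrow> ('a \<Rightarrow> 'a \<Rightarrow> 'a) \<Rightarrow>
     ('s::semigroup_mult \<Rightarrow> 'a \<Rightarrow> 'a) \<Rightarrow> ('a \<Rightarrow> 'a) \<Rightarrow> bool" where
  "rbf_hom_algebra s lam A m P \<theta> \<longleftrightarrow>
     vector_space s \<and> module.subspace s A \<and>
     bilinear_map_on s s s A A A m \<and>
     (\<forall>\<omega>. linear_map_on s s A A (P \<omega>)) \<and>
     linear_map_on s s A A \<theta> \<and>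
     (\<forall>x\<in>A. \<forall>y\<in>A. \<forall>z\<in>A. m (\<theta> x) (m y z) = m (m x y) (\<theta> z)) \<and>
     (\<forall>x\<in>A. \<forall>y\<in>A. \<forall>\<alpha> \<beta>.
        m (P \<alpha> x) (P \<beta> y) = P (\<alpha> * \<beta>) (m (P \<alpha> x) y + m x (P \<beta> y) + s lam (m x y))) \<and>
     (\<forall>x\<in>A. \<forall>\<omega>. P \<omega> (\<theta> x) = \<theta> (P \<omega> x))"

text \<open>
  The fields of an extending datum are, in order,
  \<open>\<triangleright>\<close>, \<open>\<triangleleft>\<close>, \<open>\<rightharpoonup>\<close>, \<open>\<leftharpoonup>\<close>, \<open>f\<close>, \<open>\<cdot>\<^sub>V\<close>, \<open>Q\<close>, \<open>P\<^sub>V\<close>, \<open>\<eta>\<close>, \<open>\<theta>\<^sub>V\<close>.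
\<close>

record ('r, 'v, 's) ext_datum =
  rtri :: "'r \<Rightarrow> 'v \<Rightarrow> 'v"
  ltri :: "'v \<Rightarrow> 'r \<Rightarrow> 'v"
  rharp :: "'v \<Rightarrow> 'r \<Rightarrow> 'r"
  lharp :: "'r \<Rightarrow> 'v \<Rightarrow> 'r"
  fmap :: "'v \<Rightarrow> 'v \<Rightarrow> 'r"
  mulV :: "'v \<Rightarrow> 'v \<Rightarrow> 'v"
  Qmap :: "'s \<Rightarrow> 'v \<Rightarrow> 'r"
  PV :: "'s \<Rightarrow> 'v \<Rightarrow> 'v"
  eta :: "'v \<Rightarrow> 'r"
  thetaV :: "'v \<Rightarrow> 'v"

definition extending_data ::
    "('k::field \<Rightarrow> 'r::ab_group_add \<Rightarrow> 'r) \<Rightarrow> 'r set \<Rightarrow>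
     ('k \<Rightarrow> 'v::ab_group_add \<Rightarrow> 'v) \<Rightarrow> 'v set \<Rightarrow> ('r, 'v, 's) ext_datum set" where
  "extending_data s R t V = {D.
     rtri D \<in> Bilin s t t R V V \<and>
     ltri D \<in> Bilin t s t V R V \<and>
     rharp D \<in> Bilin t s s V R R \<and>
     lharp D \<in> Bilin s t s R V R \<and>
     fmap D \<in> Bilin t t s V V R \<and>
     mulV D \<in> Bilin t t t V V V \<and>
     (\<forall>\<omega>. Qmap D \<omega> \<in> Lin t s V R) \<and>
     (\<forall>\<omega>. PV D \<omega> \<in> Lin t t V V) \<and>
     eta D \<in> Lin t s V R \<and>
     thetaV D \<in> Lin t t V V}"

definition bar_mul ::
    "('r::ab_group_add \<Rightarrow> 'r \<Rightarrow> 'r) \<Rightarrow> ('r, 'v::ab_group_add, 's) ext_datum \<Rightarrow>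
     'r \<times> 'v \<Rightarrow> 'r \<times> 'v \<Rightarrow> 'r \<times> 'v" where
  "bar_mul m D = (\<lambda>(a, x) (b, y).
     (m a b + lharp D a y + rharp D x b + fmap D x y,
      rtri D a y + ltri D x b + mulV D x y))"

definition bar_P ::
    "('s \<Rightarrow> 'r::ab_group_add \<Rightarrow> 'r) \<Rightarrow> ('r, 'v::ab_group_add, 's) ext_datum \<Rightarrow>
     's \<Rightarrow> 'r \<times> 'v \<Rightarrow> 'r \<times> 'v" where
  "bar_P P D \<omega> = (\<lambda>(a, x). (P \<omega> a + Qmap D \<omega> x, PV D \<omega> x))"

definition bar_theta ::
    "('r::ab_group_add \<Rightarrow> 'r) \<Rightarrow> ('r, 'v::ab_group_add, 's) ext_datum \<Rightarrow>
     'r \<times> 'v \<Rightarrow> 'r \<times> 'v" where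
  "bar_theta \<theta> D = (\<lambda>(a, x). (\<theta> a + eta D x, thetaV D x))"

definition extending_structures ::
    "('k::field \<Rightarrow> 'r::ab_group_add \<Rightarrow> 'r) \<Rightarrow> 'k \<Rightarrow> 'r set \<Rightarrow> ('r \<Rightarrow> 'r \<Rightarrow> 'r) \<Rightarrow>
     ('s::semigroup_mult \<Rightarrow> 'r \<Rightarrow> 'r) \<Rightarrow> ('r \<Rightarrow> 'r) \<Rightarrow>
     ('k \<Rightarrow> 'v::ab_group_add \<Rightarrow> 'v) \<Rightarrow> 'v set \<Rightarrow> ('r, 'v, 's) ext_datum set" where
  "extending_structures s lam R m P \<theta> t V =
     {D \<in> extending_data s R t V.
        rbf_hom_algebra (module_prod.scale s t) lam (R \<times> V)
          (bar_mul m D) (bar_P P D) (bar_theta \<theta> D)}"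

text \<open>
  The fields of a flag datum are, in order,
  \<open>l\<close>, \<open>r\<close>, \<open>t\<^sub>r\<close>, \<open>t\<^sub>l\<close>, \<open>a\<^sub>1\<close>, \<open>k\<^sub>1\<close>, \<open>(b\<^sub>\<omega>)\<close>, \<open>(k\<^sub>\<omega>)\<close>, \<open>a\<^sub>2\<close>, \<open>k\<^sub>2\<close>.
\<close>

record ('k, 'r, 's) flag_datum =
  fl_l :: "'r \<Rightarrow> 'k"
  fl_r :: "'r \<Rightarrow> 'k"
  fl_tr :: "'r \<Rightarrow> 'r"
  fl_tl :: "'r \<Rightarrow> 'r"
  fl_a1 :: "'r"
  fl_k1 :: "'k"
  fl_b :: "'s \<Rightarrow> 'r"
  fl_k :: "'s \<Rightarrow> 'k"
  fl_a2 :: "'r"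
  fl_k2 :: "'k"

context
  fixes s :: "'k::field \<Rightarrow> 'r::ab_group_add \<Rightarrow> 'r" (infixr "*s" 75)
    and lam :: 'k
    and R :: "'r set"
    and m :: "'r \<Rightarrow> 'r \<Rightarrow> 'r" (infixl "\<cdot>" 70)
    and P :: "'s::semigroup_mult \<Rightarrow> 'r \<Rightarrow> 'r"
    and \<theta> :: "'r \<Rightarrow> 'r"
begin

definition flag_conditions ::
    "('r \<Rightarrow> 'k) \<Rightarrow> ('r \<Rightarrow> 'k) \<Rightarrow> ('r \<Rightarrow> 'r) \<Rightarrow> ('r \<Rightarrow> 'r) \<Rightarrow> 'r \<Rightarrow> 'k \<Rightarrow>
     ('s \<Rightarrow> 'r) \<Rightarrow> ('s \<Rightarrow> 'k) \<Rightarrow> 'r \<Rightarrow> 'k \<Rightarrow> bool" where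
  "flag_conditions l r t\<^sub>r t\<^sub>l a1 k1 b k a2 k2 \<longleftrightarrow>
    (\<forall>a\<in>R. \<forall>c\<in>R.
      l (a \<cdot> c) * k2 = l (\<theta> a) * l c \<and>
      r a * r (\<theta> c) = r (a \<cdot> c) * k2 \<and>
      l a * r (\<theta> c) = l (\<theta> a) * r c) \<and>
    (\<forall>a\<in>R. \<forall>\<alpha> \<beta>.
      l (P \<alpha> a) * k \<beta> = k (\<alpha> * \<beta>) * (l (P \<alpha> a) + l a * k \<beta> + lam * l a) \<and>
      k \<alpha> * r (P \<beta> a) = k (\<alpha> * \<beta>) * (k \<alpha> * r a + r (P \<beta> a) + lam * r a)) \<and>
    (\<forall>a\<in>R. \<forall>c\<in>R.
      (a \<cdot> c) \<cdot> a2 + k2 *s t\<^sub>l (a \<cdot> c) = \<theta> a \<cdot> t\<^sub>l c + l c *s t\<^sub>l (\<theta> a) \<and>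
      t\<^sub>r a \<cdot> \<theta> c + r a *s t\<^sub>r (\<theta> c) = a2 \<cdot> (a \<cdot> c) + k2 *s t\<^sub>r (a \<cdot> c) \<and>
      t\<^sub>l a \<cdot> \<theta> c + l a *s t\<^sub>r (\<theta> c) = \<theta> a \<cdot> t\<^sub>r c + r c *s t\<^sub>l (\<theta> a)) \<and>
    (\<forall>a\<in>R.
      a1 \<cdot> \<theta> a + k1 *s t\<^sub>r (\<theta> a)
        = a2 \<cdot> t\<^sub>r a + r a *s t\<^sub>l a2 + k2 *s t\<^sub>r (t\<^sub>r a) + (k2 * r a) *s a1 \<and>
      k1 * r (\<theta> a) = l a2 * r a + k2 * r (t\<^sub>r a) + k1 * k2 * r a \<and>
      t\<^sub>l a \<cdot> a2 + k2 *s t\<^sub>l (t\<^sub>l a) + l a *s t\<^sub>r a2 + (l a * k2) *s a1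
        = \<theta> a \<cdot> a1 + k1 *s t\<^sub>l (\<theta> a) \<and>
      l (t\<^sub>l a) * k2 + l a * r a2 + l a * k1 * k2 = l (\<theta> a) * k1 \<and>
      t\<^sub>r a \<cdot> a2 + k2 *s t\<^sub>l (t\<^sub>r a) + r a *s t\<^sub>r a2 + (r a * k2) *s a1
        = a2 \<cdot> t\<^sub>l a + l a *s t\<^sub>l a2 + k2 *s t\<^sub>r (t\<^sub>l a) + (k2 * l a) *s a1 \<and>
      l (t\<^sub>r a) * k2 + r a * r a2 + r a * k1 * k2
        = l a2 * l a + k2 * r (t\<^sub>l a) + k2 * k1 * l a) \<and>
    a1 \<cdot> a2 + k2 *s t\<^sub>l a1 + k1 *s t\<^sub>r a2 = a2 \<cdot> a1 + k1 *s t\<^sub>l a2 + k2 *s t\<^sub>r a1 \<and>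
    l a1 * k2 + k1 * r a2 = l a2 * k1 + k2 * r a1 \<and>
    (\<forall>a\<in>R. \<forall>\<alpha> \<beta>.
      P \<alpha> a \<cdot> b \<beta> + k \<beta> *s t\<^sub>l (P \<alpha> a)
        = P (\<alpha> * \<beta>) (t\<^sub>l (P \<alpha> a) + a \<cdot> b \<beta> + k \<beta> *s t\<^sub>l a + lam *s t\<^sub>l a)
          + (l (P \<alpha> a) + l a * k \<beta> + lam * l a) *s b (\<alpha> * \<beta>) \<and>
      b \<alpha> \<cdot> P \<beta> a + k \<alpha> *s t\<^sub>r (P \<beta> a)
        = P (\<alpha> * \<beta>) (b \<alpha> \<cdot> a + k \<alpha> *s t\<^sub>r a + t\<^sub>r (P \<beta> a) + lam *s t\<^sub>r a)
          + (k \<alpha> * r a + r (P \<beta> a) + lam * r a) *s b (\<alpha> * \<beta>)) \<and>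
    (\<forall>\<alpha> \<beta>.
      b \<alpha> \<cdot> b \<beta> + k \<beta> *s t\<^sub>l (b \<alpha>) + k \<alpha> *s t\<^sub>r (b \<beta>) + (k \<alpha> * k \<beta>) *s a1
        = P (\<alpha> * \<beta>) (t\<^sub>l (b \<alpha>) + k \<alpha> *s a1 + t\<^sub>r (b \<beta>) + k \<beta> *s a1 + lam *s a1)
          + (l (b \<alpha>) + k \<alpha> * k1 + r (b \<beta>) + k1 * k \<beta> + lam * k1) *s b (\<alpha> * \<beta>) \<and>
      l (b \<alpha>) * k \<beta> + k \<alpha> * r (b \<beta>) + k1 * k \<alpha> * k \<beta>
        = k (\<alpha> * \<beta>) * (l (b \<alpha>) + k1 * k \<alpha> + r (b \<beta>) + k1 * k \<beta> + lam * k1)) \<and>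
    (\<forall>\<alpha>. \<theta> (b \<alpha>) + k \<alpha> *s a2 = P \<alpha> a2 + k2 *s b \<alpha>)"

definition flag_data :: "('k, 'r, 's) flag_datum set" where
  "flag_data = {F.
     fl_l F \<in> Lin s (*) R UNIV \<and> fl_r F \<in> Lin s (*) R UNIV \<and>
     fl_tr F \<in> Lin s s R R \<and> fl_tl F \<in> Lin s s R R \<and>
     fl_a1 F \<in> R \<and> (\<forall>\<omega>. fl_b F \<omega> \<in> R) \<and> fl_a2 F \<in> R \<and>
     flag_conditions (fl_l F) (fl_r F) (fl_tr F) (fl_tl F) (fl_a1 F) (fl_k1 F)
       (fl_b F) (fl_k F) (fl_a2 F) (fl_k2 F)}"

end

end

theory Submission
  imports Defs
begin

text \<open>
  All identities defining a Rota-Baxter family Hom-associative algebra are multilinear, so on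
  \<open>R \<times> V\<close> they need only be checked on the generators \<open>(a, 0)\<close>, \<open>a \<in> R\<close>, and \<open>(0, x)\<close>.
  Writing elements as \<open>(a, c x)\<close> and comparing the \<open>R\<close>-component and the coefficient of \<open>x\<close>, the
  identities on generators other than those internal to \<open>R\<close> become (F1)--(F21). A linear map on
  \<open>V\<close> is determined by its value at \<open>x\<close>, whence the bijection.
\<close>

section \<open>Linear and bilinear maps on carrier sets, and their normal forms off the
  carrier\<close>

lemma linear_map_onD:
  assumes "linear_map_on s t A B f"
  shows "y \<in> A \<Longrightarrow> f y \<in> B"
    and "y \<in> A \<Longrightarrow> z \<in> A \<Longrightarrow> f (y + z) = f y + f z"
    and "y \<in> A \<Longrightarrow> f (s c y) = t c (f y)"
  using assms unfolding linear_map_on_def by blast+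

lemma linear_map_on_zero:
  assumes "linear_map_on s t A B f" and "0 \<in> A"
  shows "f 0 = 0"
  using linear_map_onD(2)[OF assms(1,2,2)] by simp

lemma bilinear_map_onD:
  assumes "bilinear_map_on s t u A B C f"
  shows "y \<in> A \<Longrightarrow> z \<in> B \<Longrightarrow> f y z \<in> C"
    and "y \<in> A \<Longrightarrow> y' \<in> A \<Longrightarrow> z \<in> B \<Longrightarrow> f (y + y') z = f y z + f y' z"
    and "y \<in> A \<Longrightarrow> z \<in> B \<Longrightarrow> z' \<in> B \<Longrightarrow> f y (z + z') = f y z + f y z'"
    and "y \<in> A \<Longrightarrow> z \<in> B \<Longrightarrow> f (s c y) z = u c (f y z)"
    and "y \<in> A \<Longrightarrow> z \<in> B \<Longrightarrow> f y (t c z) = u c (f y z)"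
  using assms unfolding bilinear_map_on_def linear_map_on_def by blast+

lemma bilinear_map_on_zero:
  assumes "bilinear_map_on s t u A B C f"
  shows "0 \<in> A \<Longrightarrow> z \<in> B \<Longrightarrow> f 0 z = 0"
    and "y \<in> A \<Longrightarrow> 0 \<in> B \<Longrightarrow> f y 0 = 0"
  using bilinear_map_onD(2)[OF assms, of 0 0 z] bilinear_map_onD(3)[OF assms, of y 0 0]
  by simp_all

lemma bilinear_map_onI:
  assumes "\<And>y z. y \<in> A \<Longrightarrow> z \<in> B \<Longrightarrow> f y z \<in> C"
    and "\<And>y y' z. y \<in> A \<Longrightarrow> y' \<in> A \<Longrightarrow> z \<in> B \<Longrightarrow> f (y + y') z = f y z + f y' z"
    and "\<And>y z z'. y \<in> A \<Longrightarrow> z \<in> B \<Longrightarrow> z' \<in> B \<Longrightarrow> f y (z + z') = f y z + f y z'"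
    and "\<And>c y z. y \<in> A \<Longrightarrow> z \<in> B \<Longrightarrow> f (s c y) z = u c (f y z)"
    and "\<And>c y z. y \<in> A \<Longrightarrow> z \<in> B \<Longrightarrow> f y (t c z) = u c (f y z)"
  shows "bilinear_map_on s t u A B C f"
  using assms unfolding bilinear_map_on_def linear_map_on_def by auto

lemma Lin_restrict:
  assumes "module s" and "module.subspace s A" and "linear_map_on s t A B f"
  shows "restrict f A \<in> Lin s t A B"
  using assms(3) module.subspace_add[OF assms(1,2)] module.subspace_scale[OF assms(1,2)]
  unfolding Lin_def linear_map_on_def by auto

text \<open>Sums and multiples of elements of a subspace stay in it, and there restriction does not
  change values. So normalising a map to \<open>undefined\<close> off its domain preserves
  bilinearity.\<close>

lemma Bilin_restrict:
  assumes "module s" and "module t" and "module.subspace s A" and "module.subspace t B"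
    and "bilinear_map_on s t u A B C f"
  shows "(\<lambda>a\<in>A. \<lambda>b\<in>B. f a b) \<in> Bilin s t u A B C"
proof -
  note cl = module.subspace_add[OF assms(1,3)] module.subspace_scale[OF assms(1,3)]
    module.subspace_add[OF assms(2,4)] module.subspace_scale[OF assms(2,4)]
  have "bilinear_map_on s t u A B C (\<lambda>a\<in>A. \<lambda>b\<in>B. f a b)"
    by (rule bilinear_map_onI) (use bilinear_map_onD[OF assms(5)] cl in simp_all)
  moreover have "(\<lambda>a\<in>A. \<lambda>b\<in>B. f a b) \<in> A \<rightarrow>\<^sub>E (B \<rightarrow>\<^sub>E C)"
    using bilinear_map_onD(1)[OF assms(5)] by auto
  ultimately show ?thesis unfolding Bilin_def by simp
qed

lemma LinD: "f \<in> Lin s t A B \<Longrightarrow> linear_map_on s t A B f"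
  unfolding Lin_def by simp

lemma Lin_restrict_id: "f \<in> Lin s t A B \<Longrightarrow> restrict f A = f"
  unfolding Lin_def by (simp add: PiE_def extensional_restrict)

lemma BilinD: "f \<in> Bilin s t u A B C \<Longrightarrow> bilinear_map_on s t u A B C f"
  unfolding Bilin_def by simp

lemma Lin_ext:
  assumes "f \<in> Lin s t A B" and "g \<in> Lin s t A B" and "\<And>y. y \<in> A \<Longrightarrow> f y = g y"
  shows "f = g"
  using assms unfolding Lin_def by (auto intro: PiE_ext)

text \<open>Members of \<open>Bilin\<close> are extensional in the outer argument, and their values
  at points of A are extensional on B, so extensionality is applied twice.\<close>

lemma Bilin_ext:
  assumes "f \<in> Bilin s t u A B C" and "g \<in> Bilin s t u A B C"
    and "\<And>y z. y \<in> A \<Longrightarrow> z \<in> B \<Longrightarrow> f y z = g y z"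
  shows "f = g"
proof (rule PiE_ext)
  show f: "f \<in> A \<rightarrow>\<^sub>E (B \<rightarrow>\<^sub>E C)" and g: "g \<in> A \<rightarrow>\<^sub>E (B \<rightarrow>\<^sub>E C)"
    using assms unfolding Bilin_def by auto
  show "f y = g y" if "y \<in> A" for y
    using PiE_mem[OF f that] PiE_mem[OF g that] assms(3)[OF that] by (rule PiE_ext)
qed

section \<open>Linear maps out of a span, and reduction of the axioms to generators\<close>

context vector_space
begin

lemma linear_map_on_id: "linear_map_on scale scale A A (\<lambda>y. y)"
  unfolding linear_map_on_def by simp

lemma linear_map_on_add:
  assumes "subspace B" and "linear_map_on s scale A B f" and "linear_map_on s scale A B g"
  shows "linear_map_on s scale A B (\<lambda>y. f y + g y)"
  using assms(2,3) subspace_add[OF assms(1)]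
  unfolding linear_map_on_def by (auto simp: scale_right_distrib)

lemma linear_map_on_scale:
  assumes "subspace B" and "linear_map_on s scale A B f"
  shows "linear_map_on s scale A B (\<lambda>y. scale c (f y))"
  using assms(2) subspace_scale[OF assms(1)]
  unfolding linear_map_on_def by (auto simp: scale_right_distrib scale_left_commute)

text \<open>The set of points of A where f and g agree is a subspace; it contains B, hence the span
  of B.\<close>

lemma linear_map_on_eq_on_span:
  assumes "A = span B" and f: "linear_map_on scale t A C f" and g: "linear_map_on scale t A C g"
    and "\<And>y. y \<in> B \<Longrightarrow> f y = g y"
  shows "\<forall>y\<in>A. f y = g y"
proof -
  have A: "subspace A" using assms(1) by simp
  have "subspace {y \<in> A. f y = g y}"
    using subspace_0[OF A] subspace_add[OF A] subspace_scale[OF A]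
    by (intro subspaceI)
      (auto simp: linear_map_onD[OF f] linear_map_onD[OF g] linear_map_on_zero[OF f]
        linear_map_on_zero[OF g])
  moreover have "B \<subseteq> {y \<in> A. f y = g y}"
    using assms(1,4) span_base by auto
  ultimately have "span B \<subseteq> {y \<in> A. f y = g y}" by (rule span_minimal[rotated])
  then show ?thesis using assms(1) by auto
qed

end

lemma linear_map_on_comp:
  assumes "linear_map_on s t A B f" and "linear_map_on t u B C g"
  shows "linear_map_on s u A C (\<lambda>y. g (f y))"
  using assms unfolding linear_map_on_def by auto

text \<open>With the rules for identity, composition, sums and multiples, this shows by structural
  introduction that a side of an identity is linear in one chosen variable.\<close>

lemma linear_map_on_bilinear:
  assumes "bilinear_map_on s t u A B C f"
  shows "linear_map_on v s D A g \<Longrightarrow> z \<in> B \<Longrightarrow> linear_map_on v u D C (\<lambda>y. f (g y) z)"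
    and "y \<in> A \<Longrightarrow> linear_map_on v t D B h \<Longrightarrow> linear_map_on v u D C (\<lambda>z. f y (h z))"
  using assms unfolding bilinear_map_on_def
  by (auto intro: linear_map_on_comp)

text \<open>Once the operations are known to be (bi)linear, only the three identities remain. Both
  sides of each are linear in every variable separately, so agreement on B spreads to A one variable
  at a time.\<close>

lemma rbf_hom_algebra_iff_generators:
  assumes "vector_space s" and "A = module.span s B"
    and m: "bilinear_map_on s s s A A A m"
    and P: "\<And>\<omega>. linear_map_on s s A A (P \<omega>)"
    and \<theta>: "linear_map_on s s A A \<theta>"
  shows "rbf_hom_algebra s lam A m P \<theta> \<longleftrightarrow>
    (\<forall>x\<in>B. \<forall>y\<in>B. \<forall>z\<in>B. m (\<theta> x) (m y z) = m (m x y) (\<theta> z)) \<and>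
    (\<forall>x\<in>B. \<forall>y\<in>B. \<forall>\<alpha> \<beta>.
       m (P \<alpha> x) (P \<beta> y) = P (\<alpha> * \<beta>) (m (P \<alpha> x) y + m x (P \<beta> y) + s lam (m x y))) \<and>
    (\<forall>x\<in>B. \<forall>\<omega>. P \<omega> (\<theta> x) = \<theta> (P \<omega> x))" (is "_ \<longleftrightarrow> ?assoc \<and> ?rb \<and> ?comm")
proof
  interpret vector_space s by fact
  have BA: "B \<subseteq> A" using assms(2) span_superset by simp
  {
    assume "rbf_hom_algebra s lam A m P \<theta>"
    then have "\<forall>x\<in>A. \<forall>y\<in>A. \<forall>z\<in>A. m (\<theta> x) (m y z) = m (m x y) (\<theta> z)"
      and "\<forall>x\<in>A. \<forall>y\<in>A. \<forall>\<alpha> \<beta>.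
        m (P \<alpha> x) (P \<beta> y) = P (\<alpha> * \<beta>) (m (P \<alpha> x) y + m x (P \<beta> y) + s lam (m x y))"
      and "\<forall>x\<in>A. \<forall>\<omega>. P \<omega> (\<theta> x) = \<theta> (P \<omega> x)"
      unfolding rbf_hom_algebra_def by blast+
    then show "?assoc \<and> ?rb \<and> ?comm" using BA by (meson subsetD)
  }
  assume gen: "?assoc \<and> ?rb \<and> ?comm"
  have A: "subspace A" using assms(2) by simp
  note eqI = linear_map_on_eq_on_span[OF assms(2), where t = s and C = A]
  note lin = linear_map_on_id linear_map_on_comp[OF _ P] linear_map_on_comp[OF _ \<theta>]
    linear_map_on_bilinear[OF m] linear_map_on_add[OF A] linear_map_on_scale[OF A]
  note mem = bilinear_map_onD(1)[OF m] linear_map_onD(1)[OF P]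
    linear_map_onD(1)[OF \<theta>]
  \<comment> \<open>Hom-associativity is extended from B to A first in z, then in y, then in x. Each
    stage supplies the agreement on B that the next one needs.\<close>
  have a1: "\<forall>z\<in>A. m (\<theta> x) (m y z) = m (m x y) (\<theta> z)" if "x \<in> B" "y \<in> B" for x y
    by (rule eqI) (use gen that BA in \<open>auto intro!: lin mem\<close>)
  have a2: "\<forall>y\<in>A. m (\<theta> x) (m y z) = m (m x y) (\<theta> z)" if "x \<in> B" "z \<in> A" for x z
    by (rule eqI) (use a1 that BA in \<open>auto intro!: lin mem\<close>)
  have a3: "\<forall>x\<in>A. m (\<theta> x) (m y z) = m (m x y) (\<theta> z)" if "y \<in> A" "z \<in> A" for y z
    by (rule eqI) (use a2 that BA in \<open>auto intro!: lin mem\<close>)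
  \<comment> \<open>For fixed \<alpha> and \<beta> both sides are bilinear in x and y, because
    \<open>P (\<alpha> * \<beta>)\<close> and scaling by \<open>lam\<close> are linear.\<close>
  have r1: "\<forall>y\<in>A. m (P \<alpha> x) (P \<beta> y) = P (\<alpha> * \<beta>) (m (P \<alpha> x) y + m x (P \<beta> y) + s lam (m x y))"
    if "x \<in> B" for x \<alpha> \<beta>
    by (rule eqI) (use gen that BA in \<open>auto intro!: lin mem\<close>)
  have r2: "\<forall>x\<in>A. m (P \<alpha> x) (P \<beta> y) = P (\<alpha> * \<beta>) (m (P \<alpha> x) y + m x (P \<beta> y) + s lam (m x y))"
    if "y \<in> A" for y \<alpha> \<beta>
    by (rule eqI) (use r1 that BA in \<open>auto intro!: lin mem\<close>)
  have c1: "\<forall>x\<in>A. P \<omega> (\<theta> x) = \<theta> (P \<omega> x)" for \<omega>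
    by (rule eqI) (use gen BA in \<open>auto intro!: lin mem\<close>)
  show "rbf_hom_algebra s lam A m P \<theta>"
    unfolding rbf_hom_algebra_def using assms(1) A m P \<theta> a3 r2 c1 by blast
qed

section \<open>Linearity of the bar operations on the product of R and V\<close>

lemma bilinear_map_on_bar_mul:
  fixes s :: "'k::field \<Rightarrow> 'r::ab_group_add \<Rightarrow> 'r" and t :: "'k \<Rightarrow> 'v::ab_group_add \<Rightarrow> 'v"
  assumes "vector_space s" and "vector_space t"
    and R: "module.subspace s R" and V: "module.subspace t V"
    and m: "bilinear_map_on s s s R R R m" and D: "D \<in> extending_data s R t V"
  shows "bilinear_map_on (module_prod.scale s t) (module_prod.scale s t) (module_prod.scale s t)
    (R \<times> V) (R \<times> V) (R \<times> V) (bar_mul m D)"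
proof -
  interpret vector_space_prod s t
    using assms(1,2) by (simp add: vector_space_prod_def vector_space_pair_def)
  have D: "bilinear_map_on s t t R V V (rtri D)" "bilinear_map_on t s t V R V (ltri D)"
    "bilinear_map_on t s s V R R (rharp D)" "bilinear_map_on s t s R V R (lharp D)"
    "bilinear_map_on t t s V V R (fmap D)" "bilinear_map_on t t t V V V (mulV D)"
    using D unfolding extending_data_def by (auto dest: BilinD)
  note bil = m D
  note Dm = bil[THEN bilinear_map_onD(1)] bil[THEN bilinear_map_onD(2)]
    bil[THEN bilinear_map_onD(3)] bil[THEN bilinear_map_onD(4)] bil[THEN bilinear_map_onD(5)]
    vs1.subspace_add[OF R] vs2.subspace_add[OF V] vs1.subspace_scale[OF R] vs2.subspace_scale[OF V]
  show ?thesis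
    by (rule bilinear_map_onI)
      (auto simp: bar_mul_def scale_def Dm vs1.scale_right_distrib vs2.scale_right_distrib algebra_simps)
qed

text \<open>This is an upper triangular block operator. It covers \<open>bar_P\<close>, with blocks
  \<open>P \<omega>\<close>, \<open>Qmap D \<omega>\<close>, \<open>PV D \<omega>\<close>, and
  \<open>bar_theta\<close>, with blocks \<theta>, \<open>eta D\<close>,
  \<open>thetaV D\<close>.\<close>

lemma linear_map_on_block:
  fixes s :: "'k::field \<Rightarrow> 'r::ab_group_add \<Rightarrow> 'r" and t :: "'k \<Rightarrow> 'v::ab_group_add \<Rightarrow> 'v"
  assumes "vector_space s" and "vector_space t" and R: "module.subspace s R"
    and f: "linear_map_on s s R R f" and g: "linear_map_on t s V R g" and h: "linear_map_on t t V V h"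
  shows "linear_map_on (module_prod.scale s t) (module_prod.scale s t) (R \<times> V) (R \<times> V)
    (\<lambda>(a, x). (f a + g x, h x))"
proof -
  interpret vector_space_prod s t
    using assms(1,2) by (simp add: vector_space_prod_def vector_space_pair_def)
  show ?thesis
    using vs1.subspace_add[OF R] unfolding linear_map_on_def scale_def
    by (auto simp: linear_map_onD[OF f] linear_map_onD[OF g] linear_map_onD[OF h]
        vs1.scale_right_distrib)
qed

section \<open>Coordinates on a line, and the maps on it determined by their values at x\<close>

locale line = vector_space scl
  for scl :: "'k::field \<Rightarrow> 'e::ab_group_add \<Rightarrow> 'e" (infixr "*s" 75) +
  fixes x :: 'e
  assumes x_nonzero: "x \<noteq> 0"
begin

text \<open>The value is meaningful only on \<open>span {x}\<close>, where the scalar exists and is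
  unique because x is nonzero.\<close>

definition coord :: "'e \<Rightarrow> 'k" where
  "coord v = (THE c. v = c *s x)"

lemma coord_scale [simp]: "coord (c *s x) = c"
  unfolding coord_def using x_nonzero by (intro the_equality) auto

lemma coord_basis [simp]: "coord x = 1"
  using coord_scale[of 1] by simp

lemma scale_coord: "v \<in> span {x} \<Longrightarrow> coord v *s x = v"
  by (auto simp: span_singleton)

lemma scale_in_line [simp]: "c *s x \<in> span {x}"
  by (simp add: span_scale span_base)

lemma basis_in_line [simp]: "x \<in> span {x}"
  by (simp add: span_base)

lemma coord_add: "v \<in> span {x} \<Longrightarrow> w \<in> span {x} \<Longrightarrow> coord (v + w) = coord v + coord w"
  by (auto simp: span_singleton simp flip: scale_left_distrib)

lemma coord_mult: "v \<in> span {x} \<Longrightarrow> coord (c *s v) = c * coord v"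
  by (auto simp: span_singleton)

lemma linear_map_on_coord: "linear_map_on (*s) (*) (span {x}) UNIV coord"
  unfolding linear_map_on_def by (simp add: coord_add coord_mult)

lemma linear_map_on_to_line:
  "linear_map_on s (*) A UNIV l \<Longrightarrow> linear_map_on s (*s) A (span {x}) (\<lambda>a. l a *s x)"
  unfolding linear_map_on_def by (simp add: scale_left_distrib)

text \<open>Every vector of the line is a multiple of x, and the scalar pulls out of both maps. This
  lemma and its three bilinear analogues give the uniqueness half of the correspondence.\<close>

lemma Lin_line_eqI:
  assumes "f \<in> Lin (*s) t (span {x}) B" and "g \<in> Lin (*s) t (span {x}) B" and "f x = g x"
  shows "f = g"
  using assms(1,2)
proof (rule Lin_ext)
  fix v assume "v \<in> span {x}"
  then obtain c where "v = c *s x" by (auto simp: span_singleton)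
  then show "f v = g v"
    using assms(3) by (simp add: assms(1,2)[THEN LinD, THEN linear_map_onD(3)])
qed

lemma Bilin_line_right_eqI:
  assumes "f \<in> Bilin s (*s) u A (span {x}) C" and "g \<in> Bilin s (*s) u A (span {x}) C"
    and "\<And>a. a \<in> A \<Longrightarrow> f a x = g a x"
  shows "f = g"
  using assms(1,2)
proof (rule Bilin_ext)
  fix a v assume "a \<in> A" and "v \<in> span {x}"
  then obtain c where "v = c *s x" by (auto simp: span_singleton)
  then show "f a v = g a v"
    using assms(3) \<open>a \<in> A\<close> by (simp add: assms(1,2)[THEN BilinD, THEN bilinear_map_onD(5)])
qed

lemma Bilin_line_left_eqI:
  assumes "f \<in> Bilin (*s) t u (span {x}) B C" and "g \<in> Bilin (*s) t u (span {x}) B C"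
    and "\<And>b. b \<in> B \<Longrightarrow> f x b = g x b"
  shows "f = g"
  using assms(1,2)
proof (rule Bilin_ext)
  fix v b assume "v \<in> span {x}" and "b \<in> B"
  then obtain c where "v = c *s x" by (auto simp: span_singleton)
  then show "f v b = g v b"
    using assms(3) \<open>b \<in> B\<close> by (simp add: assms(1,2)[THEN BilinD, THEN bilinear_map_onD(4)])
qed

lemma Bilin_line_line_eqI:
  assumes "f \<in> Bilin (*s) (*s) u (span {x}) (span {x}) C"
    and "g \<in> Bilin (*s) (*s) u (span {x}) (span {x}) C" and "f x x = g x x"
  shows "f = g"
  using assms(1,2)
\<comment> \<open>This reduces the first argument to x; homogeneity in the second argument then
  reduces the other one to x as well.\<close>
proof (rule Bilin_line_left_eqI)
  fix v assume "v \<in> span {x}"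
  then obtain c where "v = c *s x" by (auto simp: span_singleton)
  then show "f x v = g x v"
    using assms(3) by (simp add: assms(1,2)[THEN BilinD, THEN bilinear_map_onD(5)])
qed

text \<open>This is the existence half: \<open>coord\<close> is linear with value 1 at x, so the map
  takes the prescribed value y there. The three bilinear analogues prescribe values at x in one
  argument or in both.\<close>

lemma Lin_line:
  "subspace B \<Longrightarrow> y \<in> B \<Longrightarrow> (\<lambda>v\<in>span {x}. coord v *s y) \<in> Lin (*s) (*s) (span {x}) B"
  by (rule Lin_restrict[OF module_axioms])
    (auto simp: linear_map_on_def coord_add coord_mult scale_left_distrib subspace_scale)

lemma Bilin_line_right:
  assumes "subspace A" and "subspace C" and g: "linear_map_on (*s) (*s) A C g"
  shows "(\<lambda>a\<in>A. \<lambda>v\<in>span {x}. coord v *s g a) \<in> Bilin (*s) (*s) (*s) A (span {x}) C"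
  using module_axioms module_axioms assms(1) subspace_span
  by (rule Bilin_restrict, intro bilinear_map_onI)
    (auto simp: coord_add coord_mult scale_left_distrib scale_right_distrib scale_left_commute
      subspace_scale[OF assms(2)] linear_map_onD[OF g])

lemma Bilin_line_left:
  assumes "subspace A" and "subspace C" and g: "linear_map_on (*s) (*s) A C g"
  shows "(\<lambda>v\<in>span {x}. \<lambda>a\<in>A. coord v *s g a) \<in> Bilin (*s) (*s) (*s) (span {x}) A C"
  using module_axioms module_axioms subspace_span assms(1)
  by (rule Bilin_restrict, intro bilinear_map_onI)
    (auto simp: coord_add coord_mult scale_left_distrib scale_right_distrib scale_left_commute
      subspace_scale[OF assms(2)] linear_map_onD[OF g])

lemma Bilin_line_line:
  assumes "subspace C" and "y \<in> C"
  shows "(\<lambda>v\<in>span {x}. \<lambda>w\<in>span {x}. (coord v * coord w) *s y)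
    \<in> Bilin (*s) (*s) (*s) (span {x}) (span {x}) C"
  using module_axioms module_axioms subspace_span subspace_span
  by (rule Bilin_restrict, intro bilinear_map_onI)
    (auto simp: coord_add coord_mult distrib_left distrib_right scale_left_distrib ac_simps
      subspace_scale[OF assms])

end

section \<open>The correspondence between flag data and extending data\<close>

locale rbf_hom_algebra_line = line scl x
  for scl :: "'k::field \<Rightarrow> 'e::ab_group_add \<Rightarrow> 'e" (infixr "*s" 75) and x :: 'e +
  fixes lam :: 'k and R :: "'e set" and m :: "'e \<Rightarrow> 'e \<Rightarrow> 'e" (infixl "\<cdot>" 70)
    and P :: "'s::semigroup_mult \<Rightarrow> 'e \<Rightarrow> 'e" and \<theta> :: "'e \<Rightarrow> 'e"
  assumes algebra: "rbf_hom_algebra (*s) lam R m P \<theta>"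
begin

sublocale vector_space_prod "(*s)" "(*s)" ..

lemma subspace_R: "subspace R"
  and mult_bilinear: "bilinear_map_on (*s) (*s) (*s) R R R m"
  and P_linear: "linear_map_on (*s) (*s) R R (P \<omega>)"
  and theta_linear: "linear_map_on (*s) (*s) R R \<theta>"
  and hom_assoc: "a \<in> R \<Longrightarrow> b \<in> R \<Longrightarrow> c \<in> R \<Longrightarrow> \<theta> a \<cdot> (b \<cdot> c) = a \<cdot> b \<cdot> \<theta> c"
  and rota_baxter: "a \<in> R \<Longrightarrow> b \<in> R \<Longrightarrow>
    P \<alpha> a \<cdot> P \<beta> b = P (\<alpha> * \<beta>) (P \<alpha> a \<cdot> b + a \<cdot> P \<beta> b + lam *s (a \<cdot> b))"
  and P_theta: "a \<in> R \<Longrightarrow> P \<omega> (\<theta> a) = \<theta> (P \<omega> a)"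
  using algebra unfolding rbf_hom_algebra_def by blast+

lemmas R_closed [simp] = subspace_0[OF subspace_R] subspace_add[OF subspace_R]
  subspace_scale[OF subspace_R] bilinear_map_onD(1)[OF mult_bilinear]
  linear_map_onD(1)[OF P_linear] linear_map_onD(1)[OF theta_linear]

lemmas R_zero [simp] = bilinear_map_on_zero[OF mult_bilinear]
  linear_map_on_zero[OF P_linear] linear_map_on_zero[OF theta_linear]

text \<open>These are flag data before \<open>flag_conditions\<close> is imposed. They already
  correspond bijectively to all extending data, so the conditions can be matched with the algebra
  axioms separately.\<close>

definition linear_flag_data :: "('k, 'e, 's) flag_datum set" where
  "linear_flag_data = {F.
     fl_l F \<in> Lin (*s) (*) R UNIV \<and> fl_r F \<in> Lin (*s) (*) R UNIV \<and>
     fl_tr F \<in> Lin (*s) (*s) R R \<and> fl_tl F \<in> Lin (*s) (*s) R R \<and>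
     fl_a1 F \<in> R \<and> (\<forall>\<omega>. fl_b F \<omega> \<in> R) \<and> fl_a2 F \<in> R}"

text \<open>This is the map \<Phi> of the theorem: the prescribed values at x are extended
  (bi)linearly through \<open>coord\<close>. The restrictions provide the extensionality that
  \<open>Lin\<close> and \<open>Bilin\<close> demand.\<close>

definition ext_of_flag :: "('k, 'e, 's) flag_datum \<Rightarrow> ('e, 'e, 's) ext_datum" where
  "ext_of_flag F =
     \<lparr>rtri = (\<lambda>a\<in>R. \<lambda>v\<in>span {x}. coord v *s fl_l F a *s x),
      ltri = (\<lambda>v\<in>span {x}. \<lambda>a\<in>R. coord v *s fl_r F a *s x),
      rharp = (\<lambda>v\<in>span {x}. \<lambda>a\<in>R. coord v *s fl_tr F a),
      lharp = (\<lambda>a\<in>R. \<lambda>v\<in>span {x}. coord v *s fl_tl F a),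
      fmap = (\<lambda>v\<in>span {x}. \<lambda>w\<in>span {x}. (coord v * coord w) *s fl_a1 F),
      mulV = (\<lambda>v\<in>span {x}. \<lambda>w\<in>span {x}. (coord v * coord w) *s fl_k1 F *s x),
      Qmap = (\<lambda>\<omega>. \<lambda>v\<in>span {x}. coord v *s fl_b F \<omega>),
      PV = (\<lambda>\<omega>. \<lambda>v\<in>span {x}. coord v *s fl_k F \<omega> *s x),
      eta = (\<lambda>v\<in>span {x}. coord v *s fl_a2 F),
      thetaV = (\<lambda>v\<in>span {x}. coord v *s fl_k2 F *s x)\<rparr>"

text \<open>The candidate inverse reads off values at x. Off R a term such as
  \<open>lharp D a x\<close> is an unspecified function applied to x, and a coordinate of such a
  value need not be \<open>undefined\<close>; restricting to R restores the normal form.\<close>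

definition flag_of_ext :: "('e, 'e, 's) ext_datum \<Rightarrow> ('k, 'e, 's) flag_datum" where
  "flag_of_ext D =
     \<lparr>fl_l = (\<lambda>a\<in>R. coord (rtri D a x)), fl_r = (\<lambda>a\<in>R. coord (ltri D x a)),
      fl_tr = (\<lambda>a\<in>R. rharp D x a), fl_tl = (\<lambda>a\<in>R. lharp D a x),
      fl_a1 = fmap D x x, fl_k1 = coord (mulV D x x),
      fl_b = (\<lambda>\<omega>. Qmap D \<omega> x), fl_k = (\<lambda>\<omega>. coord (PV D \<omega> x)),
      fl_a2 = eta D x, fl_k2 = coord (thetaV D x)\<rparr>"

lemma ext_of_flag_apply:
  assumes "a \<in> R"
  shows "rtri (ext_of_flag F) a (c *s x) = (c * fl_l F a) *s x"
    and "ltri (ext_of_flag F) (c *s x) a = (c * fl_r F a) *s x"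
    and "rharp (ext_of_flag F) (c *s x) a = c *s fl_tr F a"
    and "lharp (ext_of_flag F) a (c *s x) = c *s fl_tl F a"
    and "fmap (ext_of_flag F) (c *s x) (d *s x) = (c * d) *s fl_a1 F"
    and "mulV (ext_of_flag F) (c *s x) (d *s x) = (c * d * fl_k1 F) *s x"
    and "Qmap (ext_of_flag F) \<omega> (c *s x) = c *s fl_b F \<omega>"
    and "PV (ext_of_flag F) \<omega> (c *s x) = (c * fl_k F \<omega>) *s x"
    and "eta (ext_of_flag F) (c *s x) = c *s fl_a2 F"
    and "thetaV (ext_of_flag F) (c *s x) = (c * fl_k2 F) *s x"
  using assms by (simp_all add: ext_of_flag_def)

lemma ext_of_flag_basis:
  "a \<in> R \<Longrightarrow> rtri (ext_of_flag F) a x = fl_l F a *s x"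
  "a \<in> R \<Longrightarrow> ltri (ext_of_flag F) x a = fl_r F a *s x"
  "a \<in> R \<Longrightarrow> rharp (ext_of_flag F) x a = fl_tr F a"
  "a \<in> R \<Longrightarrow> lharp (ext_of_flag F) a x = fl_tl F a"
  "fmap (ext_of_flag F) x x = fl_a1 F"
  "mulV (ext_of_flag F) x x = fl_k1 F *s x"
  "Qmap (ext_of_flag F) \<omega> x = fl_b F \<omega>"
  "PV (ext_of_flag F) \<omega> x = fl_k F \<omega> *s x"
  "eta (ext_of_flag F) x = fl_a2 F"
  "thetaV (ext_of_flag F) x = fl_k2 F *s x"
  by (simp_all add: ext_of_flag_def)

lemma ext_of_flag_in_extending_data:
  assumes "F \<in> linear_flag_data"
  shows "ext_of_flag F \<in> extending_data (*s) R (*s) (span {x})"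
  using assms unfolding linear_flag_data_def extending_data_def ext_of_flag_def
  \<comment> \<open>The rule \<open>scale_scale\<close> would merge the scalars in
    \<open>coord v *s fl_l F a *s x\<close> and destroy the shape that the introduction rules
    match.\<close>
  by (auto intro!: Bilin_line_right Bilin_line_left Bilin_line_line Lin_line subspace_R
      linear_map_on_to_line intro: LinD simp del: scale_scale)

lemma extending_dataD:
  assumes "D \<in> extending_data (*s) R (*s) (span {x})"
  shows "rtri D \<in> Bilin (*s) (*s) (*s) R (span {x}) (span {x})"
    and "ltri D \<in> Bilin (*s) (*s) (*s) (span {x}) R (span {x})"
    and "rharp D \<in> Bilin (*s) (*s) (*s) (span {x}) R R"
    and "lharp D \<in> Bilin (*s) (*s) (*s) R (span {x}) R"
    and "fmap D \<in> Bilin (*s) (*s) (*s) (span {x}) (span {x}) R"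
    and "mulV D \<in> Bilin (*s) (*s) (*s) (span {x}) (span {x}) (span {x})"
    and "Qmap D \<omega> \<in> Lin (*s) (*s) (span {x}) R"
    and "PV D \<omega> \<in> Lin (*s) (*s) (span {x}) (span {x})"
    and "eta D \<in> Lin (*s) (*s) (span {x}) R"
    and "thetaV D \<in> Lin (*s) (*s) (span {x}) (span {x})"
  using assms unfolding extending_data_def by blast+

text \<open>Fixing the line argument at x turns each mixed bilinear map into a linear map on R;
  where the values lie on the line, composing with \<open>coord\<close> makes it a linear
  functional.\<close>

lemma flag_of_ext_in_linear_flag_data:
  assumes "D \<in> extending_data (*s) R (*s) (span {x})"
  shows "flag_of_ext D \<in> linear_flag_data"
proof -
  note D = extending_dataD[OF assms]
  note B = D(1-4)[THEN BilinD]
  have sec: "linear_map_on (*s) (*s) R C (\<lambda>a. f a x)"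
    if "bilinear_map_on (*s) (*s) (*s) R (span {x}) C f" for f C
    using that basis_in_line unfolding bilinear_map_on_def by blast
  have fst: "linear_map_on (*s) (*s) R C (f x)"
    if "bilinear_map_on (*s) (*s) (*s) (span {x}) R C f" for f C
    using that basis_in_line unfolding bilinear_map_on_def by blast
  show ?thesis
    unfolding linear_flag_data_def flag_of_ext_def
    by (auto intro!: Lin_restrict[OF module_axioms subspace_R] sec[OF B(4)] fst[OF B(3)]
        linear_map_on_comp[OF sec[OF B(1)] linear_map_on_coord]
        linear_map_on_comp[OF fst[OF B(2)] linear_map_on_coord]
        D(5)[THEN BilinD, THEN bilinear_map_onD(1)] D(7)[THEN LinD, THEN linear_map_onD(1)]
        D(9)[THEN LinD, THEN linear_map_onD(1)])
qed

text \<open>The values at x are read back unchanged on R, and the components of F on R, being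
  extensional, equal their own restrictions.\<close>

lemma flag_of_ext_of_flag:
  assumes "F \<in> linear_flag_data"
  shows "flag_of_ext (ext_of_flag F) = F"
proof -
  have "(\<lambda>a\<in>R. coord (rtri (ext_of_flag F) a x)) = restrict (fl_l F) R"
    "(\<lambda>a\<in>R. coord (ltri (ext_of_flag F) x a)) = restrict (fl_r F) R"
    "(\<lambda>a\<in>R. rharp (ext_of_flag F) x a) = restrict (fl_tr F) R"
    "(\<lambda>a\<in>R. lharp (ext_of_flag F) a x) = restrict (fl_tl F) R"
    by (auto simp: ext_of_flag_basis)
  moreover have "restrict (fl_l F) R = fl_l F" "restrict (fl_r F) R = fl_r F"
    "restrict (fl_tr F) R = fl_tr F" "restrict (fl_tl F) R = fl_tl F"
    using assms unfolding linear_flag_data_def by (auto intro: Lin_restrict_id)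
  ultimately show ?thesis
    unfolding flag_of_ext_def by (simp add: ext_of_flag_basis)
qed

text \<open>Both sides are extending data with the same values at x, so uniqueness on the line
  applies to each component. For the components with values in the line, \<open>scale_coord\<close>
  turns the coordinate back into the vector.\<close>

lemma ext_of_flag_of_ext:
  assumes "D \<in> extending_data (*s) R (*s) (span {x})"
  shows "ext_of_flag (flag_of_ext D) = D"
proof -
  note D = extending_dataD[OF assms]
  note E = extending_dataD[OF ext_of_flag_in_extending_data[OF flag_of_ext_in_linear_flag_data[OF assms]]]
  note mem = D(1,2,6)[THEN BilinD, THEN bilinear_map_onD(1)] D(8,10)[THEN LinD, THEN linear_map_onD(1)]
  note simps = ext_of_flag_basis flag_of_ext_def scale_coord mem
  show ?thesis
  proof (rule ext_datum.equality)
    show "rtri (ext_of_flag (flag_of_ext D)) = rtri D"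
      using E(1) D(1) by (rule Bilin_line_right_eqI) (simp add: simps)
    show "ltri (ext_of_flag (flag_of_ext D)) = ltri D"
      using E(2) D(2) by (rule Bilin_line_left_eqI) (simp add: simps)
    show "rharp (ext_of_flag (flag_of_ext D)) = rharp D"
      using E(3) D(3) by (rule Bilin_line_left_eqI) (simp add: simps)
    show "lharp (ext_of_flag (flag_of_ext D)) = lharp D"
      using E(4) D(4) by (rule Bilin_line_right_eqI) (simp add: simps)
    show "fmap (ext_of_flag (flag_of_ext D)) = fmap D"
      using E(5) D(5) by (rule Bilin_line_line_eqI) (simp add: simps)
    show "mulV (ext_of_flag (flag_of_ext D)) = mulV D"
      using E(6) D(6) by (rule Bilin_line_line_eqI) (simp add: simps)
    show "Qmap (ext_of_flag (flag_of_ext D)) = Qmap D"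
      by (rule ext, rule Lin_line_eqI[OF E(7) D(7)]) (simp add: simps)
    show "PV (ext_of_flag (flag_of_ext D)) = PV D"
      by (rule ext, rule Lin_line_eqI[OF E(8) D(8)]) (simp add: simps)
    show "eta (ext_of_flag (flag_of_ext D)) = eta D"
      using E(9) D(9) by (rule Lin_line_eqI) (simp add: simps)
    show "thetaV (ext_of_flag (flag_of_ext D)) = thetaV D"
      using E(10) D(10) by (rule Lin_line_eqI) (simp add: simps)
  \<comment> \<open>What remains of record equality is the \<open>more\<close> field.\<close>
  qed simp
qed

section \<open>The algebra axioms in coordinates, evaluated on generators\<close>

definition elt :: "'e \<Rightarrow> 'k \<Rightarrow> 'e \<times> 'e" where
  "elt a c = (a, c *s x)"

text \<open>As x is nonzero, an equation in the product splits into one equation in R and one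
  between scalars, which is the shape of the flag conditions.\<close>

lemma elt_eq_iff [simp]: "elt a c = elt b d \<longleftrightarrow> a = b \<and> c = d"
  using x_nonzero by (simp add: elt_def)

lemma elt_add: "elt a c + elt b d = elt (a + b) (c + d)"
  by (simp add: elt_def scale_left_distrib)

lemma elt_scale: "scale u (elt a c) = elt (u *s a) (u * c)"
  by (simp add: elt_def scale_def)

lemma bar_mul_elt:
  assumes "a \<in> R" and "b \<in> R"
  shows "bar_mul m (ext_of_flag F) (elt a c) (elt b d) =
    elt (a \<cdot> b + d *s fl_tl F a + c *s fl_tr F b + (c * d) *s fl_a1 F)
      (d * fl_l F a + c * fl_r F b + c * d * fl_k1 F)"
  using assms by (simp add: elt_def bar_mul_def ext_of_flag_apply scale_left_distrib)

lemma bar_P_elt: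
  "bar_P P (ext_of_flag F) \<omega> (elt a c) = elt (P \<omega> a + c *s fl_b F \<omega>) (c * fl_k F \<omega>)"
  \<comment> \<open>Here \<open>R_closed(1)\<close> is \<open>0 \<in> R\<close>; it supplies the
    membership assumption of \<open>ext_of_flag_apply\<close>.\<close>
  by (simp add: elt_def bar_P_def ext_of_flag_apply[OF R_closed(1)])

lemma bar_theta_elt:
  "bar_theta \<theta> (ext_of_flag F) (elt a c) = elt (\<theta> a + c *s fl_a2 F) (c * fl_k2 F)"
  by (simp add: elt_def bar_theta_def ext_of_flag_apply[OF R_closed(1)])

text \<open>Taking all of R instead of a basis makes the quantifiers over R in
  \<open>flag_conditions\<close> appear directly.\<close>

definition generators :: "('e \<times> 'e) set" where
  "generators = (\<lambda>a. elt a 0) ` R \<union> {elt 0 1}"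

lemma ball_generators: "(\<forall>X\<in>generators. Q X) \<longleftrightarrow> (\<forall>a\<in>R. Q (elt a 0)) \<and> Q (elt 0 1)"
  unfolding generators_def by auto

lemma span_generators: "p.span generators = R \<times> span {x}"
proof (rule p.span_subspace)
  show "generators \<subseteq> R \<times> span {x}"
    unfolding generators_def by (auto simp: elt_def span_zero)
  show "p.subspace (R \<times> span {x})"
    using subspace_R subspace_span by (rule subspace_Times)
  show "R \<times> span {x} \<subseteq> p.span generators"
  proof (clarify)
    fix a v assume "a \<in> R" and "v \<in> span {x}"
    \<comment> \<open>The scalar is the coordinate of v, since (a, c x) is the sum of (a, 0) and c
      times (0, x).\<close>
    then obtain c where "(a, v) = elt a 0 + scale c (elt 0 1)"
      unfolding elt_add elt_scale by (auto simp: elt_def span_singleton)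
    moreover have "elt a 0 \<in> generators" "elt 0 1 \<in> generators"
      using \<open>a \<in> R\<close> unfolding generators_def by auto
    ultimately show "(a, v) \<in> p.span generators"
      by (simp add: p.span_add p.span_scale p.span_base)
  qed
qed

text \<open>Hom-associativity on the seven kinds of triples containing \<open>elt 0 1\<close> gives
  two conditions each, one in R and one on coefficients of x. The Rota-Baxter identity does so for
  three kinds of pairs. Commutation at \<open>elt 0 1\<close> gives only one, since its coefficients
  are the same product of two scalars in either order.\<close>

lemma ext_of_flag_rbf_hom_algebra_iff:
  assumes F: "F \<in> linear_flag_data"
  shows "rbf_hom_algebra scale lam (R \<times> span {x})
      (bar_mul m (ext_of_flag F)) (bar_P P (ext_of_flag F)) (bar_theta \<theta> (ext_of_flag F)) \<longleftrightarrow>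
    flag_conditions (*s) lam R m P \<theta> (fl_l F) (fl_r F) (fl_tr F) (fl_tl F) (fl_a1 F) (fl_k1 F)
      (fl_b F) (fl_k F) (fl_a2 F) (fl_k2 F)"
proof -
  note E = extending_dataD[OF ext_of_flag_in_extending_data[OF F]]
  have F_lin: "linear_map_on (*s) (*) R UNIV (fl_l F)" "linear_map_on (*s) (*) R UNIV (fl_r F)"
    "linear_map_on (*s) (*s) R R (fl_tr F)" "linear_map_on (*s) (*s) R R (fl_tl F)"
    and F_mem: "fl_a1 F \<in> R" "\<And>\<omega>. fl_b F \<omega> \<in> R" "fl_a2 F \<in> R"
    using F unfolding linear_flag_data_def by (auto dest: LinD)
  \<comment> \<open>The generator \<open>elt 0 1\<close> has R-component 0, so the linear parts of
    the flag datum get evaluated at 0.\<close>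
  note F_simps = F_mem F_lin(3,4)[THEN linear_map_onD(1)] F_lin[THEN linear_map_on_zero, OF R_closed(1)]
  have bil: "bilinear_map_on scale scale scale (R \<times> span {x}) (R \<times> span {x}) (R \<times> span {x})
      (bar_mul m (ext_of_flag F))"
    using vector_space_axioms vector_space_axioms subspace_R subspace_span mult_bilinear
      ext_of_flag_in_extending_data[OF F]
    by (rule bilinear_map_on_bar_mul)
  have P: "linear_map_on scale scale (R \<times> span {x}) (R \<times> span {x}) (bar_P P (ext_of_flag F) \<omega>)" for \<omega>
    unfolding bar_P_def
    using vector_space_axioms vector_space_axioms subspace_R P_linear E(7,8)[THEN LinD]
    by (rule linear_map_on_block)
  have \<theta>: "linear_map_on scale scale (R \<times> span {x}) (R \<times> span {x}) (bar_theta \<theta> (ext_of_flag F))"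
    unfolding bar_theta_def
    using vector_space_axioms vector_space_axioms subspace_R theta_linear E(9,10)[THEN LinD]
    by (rule linear_map_on_block)
  note elt_simps = bar_mul_elt bar_P_elt bar_theta_elt elt_add elt_scale F_simps
  show ?thesis
    unfolding rbf_hom_algebra_iff_generators[OF p.vector_space_axioms span_generators[symmetric] bil P \<theta>]
      ball_generators
    unfolding flag_conditions_def
    \<comment> \<open>The instances lying entirely in R hold by the axioms of R. Distributing
      quantifiers over conjunctions and normalising sums, products and the orientation of equations
      makes the remaining instances match \<open>flag_conditions\<close>.\<close>
    by (simp add: elt_simps hom_assoc rota_baxter P_theta ball_conj_distrib all_conj_distrib ac_simps
        eq_commute)
qed

text \<open>\<open>ext_of_flag\<close> and \<open>flag_of_ext\<close> are mutually inverse between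
  \<open>linear_flag_data\<close> and all extending data. The flag conditions on one side amount to
  the algebra axioms on the other, so the bijection restricts to the two subsets.\<close>

theorem ext_of_flag_bij_betw:
  "bij_betw ext_of_flag (flag_data (*s) lam R m P \<theta>)
    (extending_structures (*s) lam R m P \<theta> (*s) (span {x}))"
proof (rule bij_betw_byWitness[where f' = flag_of_ext])
  have flag: "F \<in> flag_data (*s) lam R m P \<theta> \<longleftrightarrow> F \<in> linear_flag_data \<and>
      ext_of_flag F \<in> extending_structures (*s) lam R m P \<theta> (*s) (span {x})" for F
    using ext_of_flag_rbf_hom_algebra_iff ext_of_flag_in_extending_data
    unfolding flag_data_def linear_flag_data_def extending_structures_def by blast
  have ext: "D \<in> extending_data (*s) R (*s) (span {x})"
    if "D \<in> extending_structures (*s) lam R m P \<theta> (*s) (span {x})" for D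
    using that unfolding extending_structures_def by simp
  show "\<forall>F\<in>flag_data (*s) lam R m P \<theta>. flag_of_ext (ext_of_flag F) = F"
    using flag flag_of_ext_of_flag by blast
  show "\<forall>D\<in>extending_structures (*s) lam R m P \<theta> (*s) (span {x}). ext_of_flag (flag_of_ext D) = D"
    using ext ext_of_flag_of_ext by blast
  show "ext_of_flag ` flag_data (*s) lam R m P \<theta>
      \<subseteq> extending_structures (*s) lam R m P \<theta> (*s) (span {x})"
    using flag by blast
  \<comment> \<open>The equivalence \<open>flag\<close> is used from right to left at
    \<open>flag_of_ext D\<close>, whose image under \<open>ext_of_flag\<close> is D itself.\<close>
  show "flag_of_ext ` extending_structures (*s) lam R m P \<theta> (*s) (span {x})
      \<subseteq> flag_data (*s) lam R m P \<theta>"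
    using flag ext ext_of_flag_of_ext flag_of_ext_in_linear_flag_data by auto
qed

end

theorem theorem3p14:
  fixes scl :: "'k::field \<Rightarrow> 'e::ab_group_add \<Rightarrow> 'e"
    and lam :: 'k
    and R V :: "'e set"
    and m :: "'e \<Rightarrow> 'e \<Rightarrow> 'e"
    and P :: "'s::semigroup_mult \<Rightarrow> 'e \<Rightarrow> 'e"
    and \<theta> :: "'e \<Rightarrow> 'e"
    and x :: 'e
  assumes "vector_space scl"
    and "rbf_hom_algebra scl lam R m P \<theta>"
    and "has_codim scl R 1"
    and "space_complement scl R V"
    and "\<not> module.dependent scl {x}" and "module.span scl {x} = V"
  shows "\<exists>\<Phi>. bij_betw \<Phi> (flag_data scl lam R m P \<theta>)
                        (extending_structures scl lam R m P \<theta> scl V) \<and>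
     (\<forall>F \<in> flag_data scl lam R m P \<theta>.
        (\<forall>a\<in>R. rtri (\<Phi> F) a x = scl (fl_l F a) x \<and>
               ltri (\<Phi> F) x a = scl (fl_r F a) x \<and>
               lharp (\<Phi> F) a x = fl_tl F a \<and>
               rharp (\<Phi> F) x a = fl_tr F a) \<and>
        fmap (\<Phi> F) x x = fl_a1 F \<and>
        mulV (\<Phi> F) x x = scl (fl_k1 F) x \<and>
        (\<forall>\<omega>. Qmap (\<Phi> F) \<omega> x = fl_b F \<omega> \<and>
             PV (\<Phi> F) \<omega> x = scl (fl_k F \<omega>) x) \<and>
        eta (\<Phi> F) x = fl_a2 F \<and>
        thetaV (\<Phi> F) x = scl (fl_k2 F) x)"
proof -
  interpret vector_space scl by fact
  \<comment> \<open>Independence of \<open>{x}\<close> enters as x being nonzero, by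
    \<open>dependent_single\<close>.\<close>
  interpret rbf_hom_algebra_line scl x lam R m P \<theta>
    using assms(2,5) by unfold_locales (auto simp: dependent_single)
  show ?thesis
    using ext_of_flag_bij_betw assms(6) ext_of_flag_basis by (intro exI[of _ ext_of_flag]) auto
qed

end
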